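(* GNM is a family of universal approximators of continuous functions defined on compact sets. That is, let $f:\mathbb{R}\to\mathbb{R}$ be a continuous non-linear (i.e. non-affine) activation function and let $m,c\ge 1$ be integers. Then for every compact set $C\subset\mathbb{R}^m$, every continuous function $g:C\to\mathbb{R}^c$ and every $\varepsilon>0$, there exist integers $N$ and $K$ and a $K$-layer GNM $M$ with $N$ non-bias nodes, $m$ input nodes, $c$ output nodes and activation function $f$, such that $\sup_{\mathbf{x}\in C}\|M(\mathbf{x})-g(\mathbf{x})\|<\varepsilon$.
   Context: GNM (Graph Neural Machine). A $K$-layer GNM with $N$ non-bias nodes is defined on a directed graph with node set $V=\mathcal{X}\cup\mathcal{H}\cup\mathcal{Y}\cup\{v_b\}$ (disjoint union), where $\mathcal{X}$ consists of $m$ input nodes, $\mathcal{Y}$ of $c$ output nodes, $\mathcal{H}$ of $N-m-c$ hidden nodes, and $v_b$ is a single bias node. The edges are all ordered pairs $(u,v)$ with $u\in V$ and $v\in V\setminus\{v_b\}$ (including self-loops $u=v$); $v_b$ has no incoming edges. The parameters are real weights $\alpha_{uv}^{(k)}$ for every edge $(u,v)$ and every $k\in\{1,\dots,K\}$ (weights may differ across $k$). Given $\mathbf{x}\in\mathbb{R}^m$, the initial scalar features are $h^{(0)}=x_1,\dots,x_m$ on the input nodes, $1$ on $v_b$, and $0$ on all other nodes. For $k=1,\dots,K$ all non-bias nodes are updated synchronously by $h_v^{(k)}=f\big(\sum_{u\in V}\alpha_{uv}^{(k)}h_u^{(k-1)}\big)$, with $f$ replaced by the identity when $k=K$, and $h_{v_b}^{(k)}=1$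 for all $k$. The output of the GNM on $\mathbf{x}$ is $M(\mathbf{x})=(h_v^{(K)})_{v\in\mathcal{Y}}\in\mathbb{R}^c$. $\|\cdot\|$ is the Euclidean norm on $\mathbb{R}^c$. *)

theory Defs
  imports "HOL-Analysis.Analysis" "HOL-Library.Extended_Real"
begin

text \<open>
  The input nodes are indexed by the finite type \<open>'m\<close> and the output nodes by the finite type
  \<open>'c\<close>, so that inputs live in \<open>real ^ 'm\<close> and outputs in \<open>real ^ 'c\<close>. The number of hidden nodes
  varies with \<open>N\<close>, so these are indexed by natural numbers.
\<close>

datatype ('m, 'c) gnm_node = Input 'm | Hidden nat | Output 'c | Bias

definition gnm_nodes :: "nat \<Rightarrow> ('m::finite, 'c::finite) gnm_node set" where
  "gnm_nodes N =
     range Input \<union> Hidden ` {..<N - CARD('m) - CARD('c)} \<union> range Output \<union> {Bias}"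

text \<open>
  \<open>\<alpha> k u v\<close> is the weight of the edge from \<open>u\<close> to \<open>v\<close> in layer \<open>k\<close>. Only its values for
  \<open>1 \<le> k \<le> K\<close>, \<open>u \<in> gnm_nodes N\<close> and \<open>v \<in> gnm_nodes N - {Bias}\<close> have any effect on
  \<open>gnm_output f N K \<alpha>\<close>.
\<close>

type_synonym ('m, 'c) gnm_weights =
  "nat \<Rightarrow> ('m, 'c) gnm_node \<Rightarrow> ('m, 'c) gnm_node \<Rightarrow> real"

primrec gnm_feature ::
  "(real \<Rightarrow> real) \<Rightarrow> nat \<Rightarrow> nat \<Rightarrow> ('m::finite, 'c::finite) gnm_weights \<Rightarrow> real ^ 'm
     \<Rightarrow> nat \<Rightarrow> ('m, 'c) gnm_node \<Rightarrow> real"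
where
  "gnm_feature f N K \<alpha> x 0 =
     (\<lambda>v. case v of Input i \<Rightarrow> x $ i | Hidden j \<Rightarrow> 0 | Output j \<Rightarrow> 0 | Bias \<Rightarrow> 1)"
| "gnm_feature f N K \<alpha> x (Suc k) =
     (\<lambda>v. if v = Bias then 1
          else (if Suc k = K then (\<lambda>t. t) else f)
                 (\<Sum>u\<in>gnm_nodes N. \<alpha> (Suc k) u v * gnm_feature f N K \<alpha> x k u))"

definition gnm_output ::
  "(real \<Rightarrow> real) \<Rightarrow> nat \<Rightarrow> nat \<Rightarrow> ('m::finite, 'c::finite) gnm_weights \<Rightarrow> real ^ 'm \<Rightarrow> real ^ 'c"
where
  "gnm_output f N K \<alpha> x = (\<chi> j. gnm_feature f N K \<alpha> x K (Output j))"

text \<open>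
  \<open>M\<close> is the input-output map of some \<open>K\<close>-layer GNM with \<open>N\<close> non-bias nodes. The bound on \<open>N\<close> says
  that the number \<open>N - CARD('m) - CARD('c)\<close> of hidden nodes is not a truncated subtraction.
\<close>

definition is_gnm ::
  "(real \<Rightarrow> real) \<Rightarrow> nat \<Rightarrow> nat \<Rightarrow> (real ^ 'm::finite \<Rightarrow> real ^ 'c::finite) \<Rightarrow> bool"
where
  "is_gnm f N K M \<longleftrightarrow>
     CARD('m) + CARD('c) \<le> N \<and> 1 \<le> K \<and>
     (\<exists>\<alpha> :: ('m, 'c) gnm_weights. M = gnm_output f N K \<alpha>)"

end

theory Submission imports Defs begin

text \<open>
  Call a function approximable if it is a locally uniform limit of affine combinations of
  \<open>t \<mapsto> f (a * t + b)\<close>. Riemann sums show that these are stable under \<open>h \<mapsto> H (t + d) - H t\<close>,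
  \<open>H\<close> an antiderivative of \<open>h\<close>. Two such steps turn \<open>f\<close> into an approximable \<open>C\<^sup>2\<close> function whose
  second derivative is a second difference of \<open>f\<close> with step \<open>d\<close>; since \<open>f\<close> is not affine, it is
  non-zero somewhere for some \<open>d\<close>. Rescaled symmetric differences at a point of non-zero curvature then
  approximate \<open>t\<^sup>2\<close>, hence also \<open>t\<close>. So one more layer can square or copy any function
  computed so far; the uniform limits of deep networks form an algebra separating points, and
  Stone--Weierstrass applies.
\<close>

section \<open>Affine spans and uniform closures\<close>

text \<open>The constants stand for the bias node. Adding one scaled generator at a time gives an
  induction rule that handles arbitrary finite combinations without indexed sums.\<close>

inductive_set affine_span :: "('a \<Rightarrow> real) set \<Rightarrow> ('a \<Rightarrow> real) set" for A where
  const: "(\<lambda>_. c) \<in> affine_span A"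
| add_scaled: "u \<in> affine_span A \<Longrightarrow> v \<in> A \<Longrightarrow> (\<lambda>x. u x + a * v x) \<in> affine_span A"

lemma affine_span_incl: "v \<in> A \<Longrightarrow> v \<in> affine_span A"
  using affine_span.add_scaled[OF affine_span.const[of 0], of v A 1] by simp

lemma affine_span_lin:
  assumes "u \<in> affine_span A" "v \<in> affine_span A"
  shows "(\<lambda>x. u x + a * v x) \<in> affine_span A"
  using assms(2)
proof induction
  case (const c)
  from assms(1) show ?case
  proof induction
    case (const d)
    show ?case using affine_span.const[of "d + a * c" A] by simp
  next
    case (add_scaled u v b)
    show ?case using affine_span.add_scaled[OF add_scaled(3,2), of b] by (simp add: algebra_simps)
  qed
next
  case (add_scaled v w b)
  show ?case using affine_span.add_scaled[OF add_scaled(3,2), of "a * b"]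
    by (simp add: algebra_simps)
qed

lemma affine_span_compose:
  assumes "u \<in> affine_span A" "\<And>v. v \<in> A \<Longrightarrow> (\<lambda>x. v (\<phi> x)) \<in> affine_span B"
  shows "(\<lambda>x. u (\<phi> x)) \<in> affine_span B"
  using assms(1)
proof induction
  case (const c)
  show ?case by (rule affine_span.const)
next
  case (add_scaled u v a)
  show ?case using affine_span_lin[OF add_scaled(3) assms(2)[OF add_scaled(2)]] .
qed

text \<open>Every finite superset \<open>V\<close> of \<open>W\<close> is allowed, extra indices
  receiving weight 0; thus several functions can later be written over one common index set.\<close>

lemma affine_span_imageD:
  assumes "u \<in> affine_span (\<phi> ` L)"
  shows "\<exists>W. finite W \<and> W \<subseteq> L \<and>
    (\<forall>V. finite V \<longrightarrow> W \<subseteq> V \<longrightarrow> (\<exists>c w. \<forall>x. u x = c + (\<Sum>p\<in>V. w p * \<phi> p x)))"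
  using assms
proof induction
  case (const c)
  have "\<exists>c' w. \<forall>x. c = c' + (\<Sum>p\<in>V. w p * \<phi> p x)" for V
    by (rule exI[of _ c], rule exI[of _ "\<lambda>_. 0"]) simp
  then show ?case by (intro exI[of _ "{}"]) auto
next
  case (add_scaled u v a)
  then obtain W q where W: "finite W" "W \<subseteq> L"
      "\<And>V. finite V \<Longrightarrow> W \<subseteq> V \<Longrightarrow> \<exists>c w. \<forall>x. u x = c + (\<Sum>p\<in>V. w p * \<phi> p x)"
    and q: "q \<in> L" "v = \<phi> q"
    by blast
  have "\<exists>c w. \<forall>x. u x + a * v x = c + (\<Sum>p\<in>V. w p * \<phi> p x)"
    if V: "finite V" "insert q W \<subseteq> V" for V
  proof -
    obtain c w where cw: "\<And>x. u x = c + (\<Sum>p\<in>V. w p * \<phi> p x)"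
      using W(3)[of V] V by blast
    \<comment> \<open>Only the weight of \<open>q\<close> changes, by \<open>a\<close>; the
      correction sum collapses to one term because \<open>q\<close> lies in
      \<open>V\<close>.\<close>
    have "u x + a * v x = c + (\<Sum>p\<in>V. (w p + (if p = q then a else 0)) * \<phi> p x)" for x
    proof -
      have "(\<Sum>p\<in>V. (w p + (if p = q then a else 0)) * \<phi> p x)
          = (\<Sum>p\<in>V. w p * \<phi> p x) + (\<Sum>p\<in>V. if p = q then a * \<phi> q x else 0)"
        unfolding sum.distrib[symmetric] by (intro sum.cong) (auto simp: algebra_simps)
      then show ?thesis
        using V by (simp add: cw q)
    qed
    then show ?thesis
      by (intro exI[of _ c] exI[of _ "\<lambda>p. w p + (if p = q then a else 0)"]) blast
  qed
  then show ?case
    using W q by (intro exI[of _ "insert q W"]) auto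
qed

section \<open>Uniform closure on a set\<close>

definition unif_closure :: "'a set \<Rightarrow> ('a \<Rightarrow> real) set \<Rightarrow> ('a \<Rightarrow> real) set" where
  "unif_closure S A = {h. \<forall>e>0. \<exists>u\<in>A. \<forall>x\<in>S. \<bar>u x - h x\<bar> < e}"

lemma unif_closureD:
  assumes "h \<in> unif_closure S A" "e > 0"
  obtains u where "u \<in> A" "\<And>x. x \<in> S \<Longrightarrow> \<bar>u x - h x\<bar> < e"
  using assms unfolding unif_closure_def by blast

lemma unif_closure_incl: "u \<in> A \<Longrightarrow> u \<in> unif_closure S A"
  unfolding unif_closure_def by force

lemma unif_closure_limit:
  assumes "\<And>e. e > 0 \<Longrightarrow> \<exists>u\<in>unif_closure S A. \<forall>x\<in>S. \<bar>u x - h x\<bar> < e"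
  shows "h \<in> unif_closure S A"
  unfolding unif_closure_def
proof (intro CollectI allI impI)
  fix e :: real assume "e > 0"
  then have e: "e / 2 > 0" by simp
  obtain u where u: "u \<in> unif_closure S A" "\<And>x. x \<in> S \<Longrightarrow> \<bar>u x - h x\<bar> < e / 2"
    using assms[OF e] by blast
  obtain v where v: "v \<in> A" "\<And>x. x \<in> S \<Longrightarrow> \<bar>v x - u x\<bar> < e / 2"
    using unif_closureD[OF u(1) e] by blast
  have "\<bar>v x - h x\<bar> < e" if "x \<in> S" for x
    using u(2)[OF that] v(2)[OF that] by linarith
  with v(1) show "\<exists>u\<in>A. \<forall>x\<in>S. \<bar>u x - h x\<bar> < e" by blast
qed

lemma unif_closure_lin:
  assumes "u \<in> unif_closure S (affine_span A)" "v \<in> unif_closure S (affine_span A)"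
  shows "(\<lambda>x. u x + a * v x) \<in> unif_closure S (affine_span A)"
  unfolding unif_closure_def
proof (intro CollectI allI impI)
  fix e :: real assume e: "e > 0"
  obtain u' where u': "u' \<in> affine_span A" "\<And>x. x \<in> S \<Longrightarrow> \<bar>u' x - u x\<bar> < e / 2"
    using unif_closureD[OF assms(1), of "e / 2"] e by (metis half_gt_zero)
  \<comment> \<open>Each summand may err by \<open>e / 2\<close>; the \<open>+ 1\<close> keeps the
    denominator positive when \<open>a = 0\<close>.\<close>
  obtain v' where v': "v' \<in> affine_span A" "\<And>x. x \<in> S \<Longrightarrow> \<bar>v' x - v x\<bar> < e / (2 * (\<bar>a\<bar> + 1))"
    using unif_closureD[OF assms(2), of "e / (2 * (\<bar>a\<bar> + 1))"] e
    by (metis abs_ge_zero add_nonneg_pos divide_pos_pos mult_pos_pos zero_less_numeral zero_less_one)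
  have "\<bar>u' x + a * v' x - (u x + a * v x)\<bar> < e" if x: "x \<in> S" for x
  proof -
    have "\<bar>a * (v' x - v x)\<bar> \<le> (\<bar>a\<bar> + 1) * (e / (2 * (\<bar>a\<bar> + 1)))"
      unfolding abs_mult using v'(2)[OF x] by (intro mult_mono) auto
    also have "\<dots> = e / 2"
      by (simp add: divide_simps add_pos_nonneg)
    finally show ?thesis
      using u'(2)[OF x] unfolding right_diff_distrib by linarith
  qed
  then show "\<exists>w\<in>affine_span A. \<forall>x\<in>S. \<bar>w x - (u x + a * v x)\<bar> < e"
    using affine_span_lin[OF u'(1) v'(1), of a] by (intro bexI) auto
qed

lemma unif_closure_const: "(\<lambda>_. c) \<in> unif_closure S (affine_span A)"
  by (intro unif_closure_incl affine_span.const)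

section \<open>Functions approximable by one layer of activations\<close>

text \<open>Intersecting over all intervals \<open>{-R..R}\<close> encodes locally uniform
  approximation on the line; for negative \<open>R\<close> the interval is empty and imposes
  nothing.\<close>

definition act_closure :: "(real \<Rightarrow> real) \<Rightarrow> (real \<Rightarrow> real) set" where
  "act_closure f = (\<Inter>R. unif_closure {-R..R} (affine_span {\<lambda>t. f (a * t + b) | a b. True}))"

lemma act_closure_self: "f \<in> act_closure f"
proof -
  have "f \<in> {\<lambda>t. f (a * t + b) | a b. True}"
    by (rule CollectI, rule exI[of _ 1], rule exI[of _ 0]) simp
  then show ?thesis
    unfolding act_closure_def by (auto intro!: unif_closure_incl affine_span_incl)
qed

lemma act_closure_const: "(\<lambda>_. c) \<in> act_closure f"
  unfolding act_closure_def by (auto intro: unif_closure_const)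

lemma act_closure_lin:
  "u \<in> act_closure f \<Longrightarrow> v \<in> act_closure f \<Longrightarrow> (\<lambda>t. u t + a * v t) \<in> act_closure f"
  unfolding act_closure_def by (auto intro: unif_closure_lin)

lemma act_closure_scale: "v \<in> act_closure f \<Longrightarrow> (\<lambda>t. a * v t) \<in> act_closure f"
  using act_closure_lin[OF act_closure_const[of 0], of v f a] by simp

lemma act_closure_sum:
  fixes n :: nat
  assumes "\<And>i. i < n \<Longrightarrow> v i \<in> act_closure f"
  shows "(\<lambda>t. \<Sum>i<n. v i t) \<in> act_closure f"
  using assms
proof (induct n)
  case 0
  show ?case using act_closure_const[of 0 f] by simp
next
  case (Suc n)
  then show ?case using act_closure_lin[of "\<lambda>t. \<Sum>i<n. v i t" f "v n" 1] by simp
qed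

lemma act_closure_limit:
  assumes "\<And>R e. e > 0 \<Longrightarrow> \<exists>u\<in>act_closure f. \<forall>t\<in>{-R..R}. \<bar>u t - h t\<bar> < e"
  shows "h \<in> act_closure f"
  unfolding act_closure_def
proof (intro INT_I unif_closure_limit)
  fix R e :: real assume "e > 0"
  then obtain u where "u \<in> act_closure f" "\<forall>t\<in>{-R..R}. \<bar>u t - h t\<bar> < e"
    using assms by blast
  then show "\<exists>u\<in>unif_closure {-R..R} (affine_span {\<lambda>t. f (a * t + b) |a b. True}).
      \<forall>t\<in>{-R..R}. \<bar>u t - h t\<bar> < e"
    unfolding act_closure_def by blast
qed

lemma act_closure_affine:
  assumes "h \<in> act_closure f"
  shows "(\<lambda>t. h (p * t + q)) \<in> act_closure f"
  unfolding act_closure_def unif_closure_def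
proof (intro INT_I CollectI allI impI)
  fix R e :: real assume e: "e > 0"
  let ?A = "{\<lambda>t. f (a * t + b) |a b. True}"
  \<comment> \<open>The enlarged interval contains the image of \<open>{-R..R}\<close> under
    \<open>t \<mapsto> p * t + q\<close>.\<close>
  have "h \<in> unif_closure {-(\<bar>p\<bar> * R + \<bar>q\<bar>)..\<bar>p\<bar> * R + \<bar>q\<bar>} (affine_span ?A)"
    using assms unfolding act_closure_def by blast
  then obtain u where u: "u \<in> affine_span ?A"
      "\<And>t. t \<in> {-(\<bar>p\<bar> * R + \<bar>q\<bar>)..\<bar>p\<bar> * R + \<bar>q\<bar>} \<Longrightarrow> \<bar>u t - h t\<bar> < e"
    using unif_closureD[OF _ e] by blast
  have "(\<lambda>t. u (p * t + q)) \<in> affine_span ?A"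
  proof (rule affine_span_compose[OF u(1)])
    fix v assume "v \<in> ?A"
    then obtain a b where v: "v = (\<lambda>t. f (a * t + b))" by blast
    have "(\<lambda>t. v (p * t + q)) = (\<lambda>t. f ((a * p) * t + (a * q + b)))"
      unfolding v by (simp add: algebra_simps)
    then show "(\<lambda>t. v (p * t + q)) \<in> affine_span ?A"
      by (intro affine_span_incl) blast
  qed
  moreover have "\<bar>u (p * t + q) - h (p * t + q)\<bar> < e" if "t \<in> {-R..R}" for t
  proof (rule u(2))
    have "\<bar>p * t\<bar> \<le> \<bar>p\<bar> * R"
      unfolding abs_mult using that by (intro mult_left_mono) auto
    then show "p * t + q \<in> {-(\<bar>p\<bar> * R + \<bar>q\<bar>)..\<bar>p\<bar> * R + \<bar>q\<bar>}"
      by (auto simp: abs_le_iff)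
  qed
  ultimately show "\<exists>u\<in>affine_span ?A. \<forall>t\<in>{-R..R}. \<bar>u t - h (p * t + q)\<bar> < e"
    by (intro bexI[of _ "\<lambda>t. u (p * t + q)"]) auto
qed

text \<open>The increment of an antiderivative is an integral over a window of fixed length, hence a
  locally uniform limit of Riemann sums of translates.\<close>

lemma act_closure_increment:
  assumes h: "h \<in> act_closure f" and cont: "continuous_on UNIV h"
    and H: "\<And>t. (H has_real_derivative h t) (at t)"
  shows "(\<lambda>t. H (t + d) - H t) \<in> act_closure f"
proof (rule act_closure_limit)
  fix R e :: real assume e: "e > 0"
  \<comment> \<open>A sample point lies within |d| of \<open>t\<close>, and the intermediate point
    of the mean value theorem within a further |d|.\<close>
  define I where "I = {-(R + 2 * \<bar>d\<bar>)..R + 2 * \<bar>d\<bar>}"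
  have "uniformly_continuous_on I h"
    unfolding I_def by (intro compact_uniformly_continuous continuous_on_subset[OF cont]) auto
  \<comment> \<open>The steps have total length |d|, so this tolerance accumulates to less than
    \<open>e\<close>; the \<open>+ 1\<close> also covers \<open>d = 0\<close>.\<close>
  moreover have e': "e / (\<bar>d\<bar> + 1) > 0" using e by (simp add: add_nonneg_pos)
  ultimately obtain \<eta> where \<eta>: "\<eta> > 0"
      "\<And>x y. x \<in> I \<Longrightarrow> y \<in> I \<Longrightarrow> \<bar>y - x\<bar> < \<eta> \<Longrightarrow> \<bar>h y - h x\<bar> < e / (\<bar>d\<bar> + 1)"
    unfolding uniformly_continuous_on_def dist_real_def by metis
  obtain n :: nat where n: "\<bar>d\<bar> / \<eta> < real n"
    using reals_Archimedean2 by blast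
  have n0: "n > 0" using n \<eta>(1) by (cases n) (auto simp: divide_simps split: if_splits)
  define s where "s = d / real n"
  have s: "\<bar>s\<bar> < \<eta>" "real n * s = d"
    using n n0 \<eta>(1) by (auto simp: s_def field_simps)
  \<comment> \<open>A Riemann sum of \<open>h\<close> from \<open>t\<close> to \<open>t + d\<close>,
    sampled at the start of each step; the factor \<open>1\<close> matches the shape of
    \<open>act_closure_affine\<close>.\<close>
  let ?u = "\<lambda>t. \<Sum>i<n. s * h (1 * t + real i * s)"
  have "?u \<in> act_closure f"
    by (intro act_closure_sum act_closure_scale act_closure_affine[OF h])
  moreover have "\<bar>?u t - (H (t + d) - H t)\<bar> < e" if t: "t \<in> {-R..R}" for t
  proof -
    have step: "\<bar>s * h (t + real i * s) - (H (t + real (Suc i) * s) - H (t + real i * s))\<bar>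
        \<le> \<bar>s\<bar> * (e / (\<bar>d\<bar> + 1))" if i: "i < n" for i
    proof -
      \<comment> \<open>The Maclaurin formula of order 1 serves as a two-sided mean value theorem,
        since \<open>s\<close> has the sign of \<open>d\<close>.\<close>
      let ?y = "t + real i * s"
      let ?D = "\<lambda>m::nat. if m = 0 then \<lambda>z. H (?y + z) else (\<lambda>z. h (?y + z))"
      have "\<exists>z. \<bar>z\<bar> \<le> \<bar>s\<bar> \<and> H (?y + s) = (\<Sum>m<1. ?D m 0 / fact m * s ^ m) + ?D 1 z / fact 1 * s ^ 1"
        by (rule Maclaurin_bi_le[where diff = ?D and f = "\<lambda>z. H (?y + z)" and x = s and n = 1])
          (auto intro!: derivative_eq_intros DERIV_chain2[OF H, THEN DERIV_cong])
      then obtain z where z: "\<bar>z\<bar> \<le> \<bar>s\<bar>" "H (?y + s) = H ?y + h (?y + z) * s"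
        by auto
      have "real i * \<bar>s\<bar> \<le> real n * \<bar>s\<bar>" "1 * \<bar>s\<bar> \<le> real n * \<bar>s\<bar>"
        using i mult_right_mono[of 1 "real n" "\<bar>s\<bar>"] by (auto intro!: mult_right_mono)
      moreover have "real n * \<bar>s\<bar> = \<bar>d\<bar>"
        using s(2) by (metis abs_mult abs_of_nat)
      moreover have "\<bar>real i * s\<bar> = real i * \<bar>s\<bar>"
        by (simp add: abs_mult)
      ultimately have "\<bar>real i * s\<bar> \<le> \<bar>d\<bar>" "\<bar>s\<bar> \<le> \<bar>d\<bar>"
        by linarith+
      then have "?y \<in> I" "?y + z \<in> I"
        using t z(1) unfolding I_def atLeastAtMost_iff by linarith+
      then have "\<bar>h (?y + z) - h ?y\<bar> \<le> e / (\<bar>d\<bar> + 1)"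
        using \<eta>(2)[of ?y "?y + z"] z(1) s(1) by simp
      then have "\<bar>s\<bar> * \<bar>h (?y + z) - h ?y\<bar> \<le> \<bar>s\<bar> * (e / (\<bar>d\<bar> + 1))"
        by (intro mult_left_mono) auto
      moreover have "s * h ?y - (H (t + real (Suc i) * s) - H ?y) = - (s * (h (?y + z) - h ?y))"
        using z(2) by (simp add: algebra_simps)
      ultimately show ?thesis
        by (simp add: abs_mult)
    qed
    have "H (t + d) - H t = (\<Sum>i<n. H (t + real (Suc i) * s) - H (t + real i * s))"
      using s(2) sum_lessThan_telescope[of "\<lambda>i. H (t + real i * s)" n] by simp
    then have "\<bar>?u t - (H (t + d) - H t)\<bar>
        = \<bar>\<Sum>i<n. s * h (t + real i * s) - (H (t + real (Suc i) * s) - H (t + real i * s))\<bar>"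
      by (simp only: sum_subtractf mult_1)
    also have "\<dots> \<le> (\<Sum>i<n. \<bar>s\<bar> * (e / (\<bar>d\<bar> + 1)))"
      using step by (intro sum_abs[THEN order_trans] sum_mono) auto
    also have "\<dots> = \<bar>d\<bar> * (e / (\<bar>d\<bar> + 1))"
      using s(2) by (auto simp: abs_mult)
    also have "\<dots> < e"
      using e by (simp add: field_simps add_nonneg_pos)
    finally show ?thesis .
  qed
  ultimately show "\<exists>u\<in>act_closure f. \<forall>t\<in>{-R..R}. \<bar>u t - (H (t + d) - H t)\<bar> < e"
    by (intro bexI[of _ ?u] ballI)
qed

text \<open>In \<open>q (t0 + s * t) + q (t0 - s * t) - 2 * q t0\<close> the first-order terms
  cancel, and the second-order term is close to \<open>s\<^sup>2 * q2 t0 * t\<^sup>2\<close> for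
  small \<open>s\<close>.\<close>

lemma act_closure_square_if_C2:
  assumes q: "q \<in> act_closure f"
    and q1: "\<And>t. (q has_real_derivative q1 t) (at t)"
    and q2: "\<And>t. (q1 has_real_derivative q2 t) (at t)"
    and cont: "continuous_on UNIV q2" and nz: "q2 t0 \<noteq> 0"
  shows "(\<lambda>t. t\<^sup>2) \<in> act_closure f"
proof (rule act_closure_limit)
  fix R e :: real assume e: "e > 0"
  \<comment> \<open>Strictly bounds |t| and stays positive even when \<open>R\<close> is
    negative.\<close>
  define B where "B = \<bar>R\<bar> + 1"
  have B: "B > 0" unfolding B_def by simp
  \<comment> \<open>Chosen so that the final error bound
    \<open>e1 / \<bar>q2 t0\<bar> * B\<^sup>2\<close> equals \<open>e / 2\<close>.\<close>
  define e1 where "e1 = e * \<bar>q2 t0\<bar> / (2 * B\<^sup>2)"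
  have e1: "e1 > 0" using e nz B by (simp add: e1_def)
  have "\<exists>\<eta>>0. \<forall>x. dist x t0 < \<eta> \<longrightarrow> dist (q2 x) (q2 t0) < e1"
    using cont e1 unfolding continuous_on_iff by auto
  then obtain \<eta> where \<eta>: "\<eta> > 0" "\<And>x. \<bar>x - t0\<bar> < \<eta> \<Longrightarrow> \<bar>q2 x - q2 t0\<bar> \<le> e1"
    unfolding dist_real_def by fastforce
  \<comment> \<open>Since \<open>s * B = \<eta> / 2\<close>, all points \<open>t0 + s * t\<close>
    and \<open>t0 - s * t\<close> stay where \<open>q2\<close> is within \<open>e1\<close> of
    \<open>q2 t0\<close>.\<close>
  define s where "s = \<eta> / (2 * B)"
  have s: "s > 0" using \<eta>(1) B by (simp add: s_def)
  define k where "k = 1 / (s\<^sup>2 * q2 t0)"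
  define u where "u = (\<lambda>t. k * (q (s * t + t0) + 1 * q ((-s) * t + t0)) + 1 * (- 2 * k * q t0))"
  have "u \<in> act_closure f"
    unfolding u_def by (intro act_closure_lin act_closure_scale act_closure_affine[OF q] act_closure_const)
  moreover have "\<bar>u t - t\<^sup>2\<bar> < e" if t: "t \<in> {-R..R}" for t
  proof -
    have D: "((\<lambda>z. q (t0 + z) + q (t0 - z)) has_real_derivative q1 (t0 + z) - q1 (t0 - z)) (at z)"
      "((\<lambda>z. q1 (t0 + z) - q1 (t0 - z)) has_real_derivative q2 (t0 + z) + q2 (t0 - z)) (at z)" for z
      by (auto intro!: derivative_eq_intros DERIV_chain2[OF q1, THEN DERIV_cong]
          DERIV_chain2[OF q2, THEN DERIV_cong])
    \<comment> \<open>The symmetrised \<open>q\<close> and its first two derivatives; the first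
      derivative vanishes at 0.\<close>
    let ?p = "\<lambda>m::nat. if m = 0 then \<lambda>z. q (t0 + z) + q (t0 - z)
      else if m = 1 then \<lambda>z. q1 (t0 + z) - q1 (t0 - z) else (\<lambda>z. q2 (t0 + z) + q2 (t0 - z))"
    have tB: "\<bar>t\<bar> < B" using t unfolding B_def by auto
    have "\<exists>z. \<bar>z\<bar> \<le> \<bar>s * t\<bar> \<and> q (t0 + s * t) + q (t0 - s * t)
        = (\<Sum>m<2. ?p m 0 / fact m * (s * t) ^ m) + ?p 2 z / fact 2 * (s * t) ^ 2"
      by (rule Maclaurin_bi_le[where diff = ?p and x = "s * t" and n = 2
            and f = "\<lambda>z. q (t0 + z) + q (t0 - z)"])
        (auto simp: less_2_cases_iff intro: D)
    then obtain z where z: "\<bar>z\<bar> \<le> \<bar>s * t\<bar>"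
      "q (t0 + s * t) + q (t0 - s * t) = 2 * q t0 + (q2 (t0 + z) + q2 (t0 - z)) / 2 * (s * t)\<^sup>2"
      by (auto simp: numeral_2_eq_2)
    have "\<bar>s * t\<bar> \<le> s * B" using tB s by (simp add: abs_mult)
    also have "\<dots> < \<eta>" using \<eta>(1) B by (simp add: s_def)
    finally have "\<bar>z\<bar> < \<eta>" using z(1) by simp
    then have "\<bar>q2 (t0 + z) - q2 t0\<bar> \<le> e1" "\<bar>q2 (t0 - z) - q2 t0\<bar> \<le> e1"
      using \<eta>(2)[of "t0 + z"] \<eta>(2)[of "t0 - z"] by auto
    then have "\<bar>(q2 (t0 + z) + q2 (t0 - z)) / 2 - q2 t0\<bar> \<le> e1"
      by (simp add: field_simps)
    moreover have "u t = k * ((q2 (t0 + z) + q2 (t0 - z)) / 2 * (s * t)\<^sup>2)"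
      using z(2) unfolding u_def by (simp add: algebra_simps)
    then have "u t = (q2 (t0 + z) + q2 (t0 - z)) / 2 / q2 t0 * t\<^sup>2"
      using s by (simp add: k_def power_mult_distrib)
    then have "u t - t\<^sup>2 = ((q2 (t0 + z) + q2 (t0 - z)) / 2 - q2 t0) / q2 t0 * t\<^sup>2"
      using nz by (simp add: field_simps)
    then have "\<bar>u t - t\<^sup>2\<bar> = \<bar>(q2 (t0 + z) + q2 (t0 - z)) / 2 - q2 t0\<bar> / \<bar>q2 t0\<bar> * t\<^sup>2"
      by (simp add: abs_mult)
    moreover have "t\<^sup>2 \<le> B\<^sup>2"
      using tB B by (intro abs_le_square_iff[THEN iffD1]) simp
    ultimately have "\<bar>u t - t\<^sup>2\<bar> \<le> e1 / \<bar>q2 t0\<bar> * B\<^sup>2"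
      by (metis abs_ge_zero divide_nonneg_nonneg divide_right_mono less_imp_le mult_mono' zero_le_power2)
    also have "\<dots> = e / 2" using B nz by (simp add: e1_def)
    finally show ?thesis using e by simp
  qed
  ultimately show "\<exists>u\<in>act_closure f. \<forall>t\<in>{-R..R}. \<bar>u t - t\<^sup>2\<bar> < e" by blast
qed

section \<open>Second differences of continuous non-affine functions\<close>

lemma antiderivative_exists:
  fixes h :: "real \<Rightarrow> real"
  assumes "continuous_on UNIV h"
  obtains H where "\<And>t. (H has_real_derivative h t) (at t)"
proof -
  have "\<exists>F. \<forall>x::real. -\<infinity> < ereal x \<longrightarrow> ereal x < \<infinity> \<longrightarrow> (F has_vector_derivative h x) (at x)"
    using assms by (intro einterval_antiderivative) (auto simp: continuous_on_eq_continuous_at)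
  then show ?thesis
    using that by (auto simp: has_real_derivative_iff_has_vector_derivative)
qed

text \<open>Integrating the midpoint equation shows that \<open>f\<close> is differentiable with constant
  derivative.\<close>

lemma affine_if_second_differences_vanish:
  fixes f :: "real \<Rightarrow> real"
  assumes cont: "continuous_on UNIV f"
    and mid: "\<And>t d. f (t + 2 * d) - 2 * f (t + d) + f t = 0"
  shows "\<exists>a b. \<forall>t. f t = a * t + b"
proof -
  obtain F where F: "\<And>t. (F has_real_derivative f t) (at t)"
    using antiderivative_exists[OF cont] by blast
  \<comment> \<open>By the midpoint equation, \<open>F (t + s) - F (t - s) - 2 * s * f t\<close> is
    constant in \<open>s\<close>; compare \<open>s = 1\<close> with \<open>s = 0\<close>. This
    exhibits \<open>f\<close> as a differentiable function.\<close>
  have f_eq: "f t = (F (t + 1) - F (t - 1)) / 2" for t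
  proof -
    have "((\<lambda>s. F (t + s) - F (t - s) - 2 * s * f t) has_real_derivative 0) (at s)" for s
    proof -
      have "f (t + s) + f (t - s) - 2 * f t = 0"
        using mid[of "t - s" s] by (simp add: algebra_simps)
      then show ?thesis
        by (auto intro!: derivative_eq_intros DERIV_chain2[OF F, THEN DERIV_cong])
    qed
    from DERIV_isconst_all[OF allI[OF this], of 1 0] show ?thesis by simp
  qed
  define a where "a = (f 1 - f (-1)) / 2"
  \<comment> \<open>The point \<open>r\<close> is the midpoint both of 0 and \<open>t + 1\<close>
    and of \<open>t\<close> and 1.\<close>
  have shift: "f (t + 1) = f t + (f 1 - f 0)" for t
  proof -
    define r where "r = (t + 1) / 2"
    have r: "t + 1 = 2 * r" "t + 2 * (r - t) = 1"
      by (simp_all add: r_def field_simps)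
    have "f (t + 1) + f 0 = 2 * f r"
      using mid[of 0 r] by (simp add: r(1))
    moreover have "f 1 + f t = 2 * f r"
      using mid[of t "r - t"] unfolding r(2) by simp
    ultimately show ?thesis by simp
  qed
  have const: "f (t + 1) - f (t - 1) = f 1 - f (-1)" for t
    using shift[of t] shift[of "t - 1"] shift[of "-1"] by simp
  have "(f has_real_derivative a) (at t)" for t
  proof -
    have "((\<lambda>t. (F (t + 1) - F (t - 1)) / 2) has_real_derivative (f (t + 1) - f (t - 1)) / 2) (at t)"
      by (auto intro!: derivative_eq_intros DERIV_chain2[OF F, THEN DERIV_cong])
    then show ?thesis by (simp add: f_eq[symmetric] const a_def)
  qed
  then have "((\<lambda>t. f t - a * t) has_real_derivative 0) (at t)" for t
    by (auto intro!: derivative_eq_intros)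
  then have "f t = a * t + f 0" for t
    using DERIV_isconst_all[of "\<lambda>t. f t - a * t" t 0] by auto
  then show ?thesis by blast
qed

lemma act_closure_square:
  fixes f :: "real \<Rightarrow> real"
  assumes cont: "continuous_on UNIV f" and nonaff: "\<not> (\<exists>a b. \<forall>t. f t = a * t + b)"
  shows "(\<lambda>t. t\<^sup>2) \<in> act_closure f"
proof -
  obtain t0 d where nz: "f (t0 + 2 * d) - 2 * f (t0 + d) + f t0 \<noteq> 0"
    using affine_if_second_differences_vanish[OF cont] nonaff by blast
  obtain F where F: "\<And>t. (F has_real_derivative f t) (at t)"
    using antiderivative_exists[OF cont] by blast
  have contF: "continuous_on UNIV F"
    using F by (meson DERIV_continuous continuous_at_imp_continuous_on)
  obtain G where G: "\<And>t. (G has_real_derivative F t) (at t)"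
    using antiderivative_exists[OF contF] by blast
  have D1: "(\<lambda>t. F (t + d) - F t) \<in> act_closure f"
    by (rule act_closure_increment[OF act_closure_self cont F])
  have G1: "((\<lambda>t. G (t + d) - G t) has_real_derivative F (t + d) - F t) (at t)" for t
    by (auto intro!: derivative_eq_intros DERIV_chain2[OF G, THEN DERIV_cong])
  have contF1: "continuous_on UNIV (\<lambda>t. F (t + d) - F t)"
    by (intro continuous_intros continuous_on_compose2[OF contF] subset_UNIV)
  have contf2: "continuous_on UNIV (\<lambda>t. f (t + d + d) - f (t + d) - (f (t + d) - f t))"
    by (intro continuous_intros continuous_on_compose2[OF cont] subset_UNIV)
  have Gd: "((\<lambda>t. G (t + d + d) - G (t + d) - (G (t + d) - G t)) has_real_derivative
      F (t + d + d) - F (t + d) - (F (t + d) - F t)) (at t)" for t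
    by (auto intro!: derivative_eq_intros DERIV_chain2[OF G, THEN DERIV_cong])
  have Fd: "((\<lambda>t. F (t + d + d) - F (t + d) - (F (t + d) - F t)) has_real_derivative
      f (t + d + d) - f (t + d) - (f (t + d) - f t)) (at t)" for t
    by (auto intro!: derivative_eq_intros DERIV_chain2[OF F, THEN DERIV_cong])
  have nz': "f (t0 + d + d) - f (t0 + d) - (f (t0 + d) - f t0) \<noteq> 0"
    using nz by (simp add: algebra_simps)
  \<comment> \<open>Here \<open>q\<close> is the second difference of \<open>G\<close>: the inner
    increment passes from \<open>f\<close> to the first difference of \<open>F\<close>, the outer
    one to that of its primitive \<open>G (t + d) - G t\<close>.\<close>
  show ?thesis
    by (rule act_closure_square_if_C2[OF act_closure_increment[OF D1 contF1 G1] Gd Fd contf2 nz'])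
qed

text \<open>The identity is \<open>((t + 1)\<^sup>2 - t\<^sup>2 - 1) / 2\<close>.\<close>

lemma act_closure_id:
  fixes f :: "real \<Rightarrow> real"
  assumes "continuous_on UNIV f" "\<not> (\<exists>a b. \<forall>t. f t = a * t + b)"
  shows "(\<lambda>t. t) \<in> act_closure f"
proof -
  note sq = act_closure_square[OF assms]
  have "(\<lambda>t. (1 * t + 1)\<^sup>2) \<in> act_closure f"
    using act_closure_affine[OF sq, of 1 1] .
  then have "(\<lambda>t. (1/2) * (1 * t + 1)\<^sup>2) \<in> act_closure f"
    by (rule act_closure_scale)
  then have "(\<lambda>t. (1/2) * (1 * t + 1)\<^sup>2 + (-1/2) * t\<^sup>2) \<in> act_closure f"
    by (rule act_closure_lin[OF _ sq])
  then have "(\<lambda>t. ((1/2) * (1 * t + 1)\<^sup>2 + (-1/2) * t\<^sup>2) + (-1/2) * 1) \<in> act_closure f"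
    by (rule act_closure_lin[OF _ act_closure_const])
  then show ?thesis
    by (simp add: power2_eq_square algebra_simps)
qed

section \<open>Density of deep networks\<close>

text \<open>The index counts activations. Members are values before activation, so
  \<open>net_layer f k\<close> corresponds to a machine with \<open>Suc k\<close> layers, the last
  of which is linear.\<close>

primrec net_layer :: "(real \<Rightarrow> real) \<Rightarrow> nat \<Rightarrow> (real ^ 'm \<Rightarrow> real) set" where
  "net_layer f 0 = affine_span (range (\<lambda>i x. x $ i))"
| "net_layer f (Suc k) = affine_span ((\<lambda>u x. f (u x)) ` net_layer f k)"

lemma net_layer_affine:
  assumes "u \<in> net_layer f k"
  shows "(\<lambda>x. a * u x + b) \<in> net_layer f k"
proof -
  have "(\<lambda>x. b + a * u x) \<in> net_layer f k"
    using assms by (cases k) (auto intro: affine_span_lin affine_span.const)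
  then show ?thesis by (simp add: add.commute)
qed

lemma net_closure_const: "(\<lambda>_. c) \<in> unif_closure S (net_layer f k)"
  by (cases k) (auto intro: unif_closure_const)

lemma net_closure_lin:
  assumes "u \<in> unif_closure S (net_layer f k)" "v \<in> unif_closure S (net_layer f k)"
  shows "(\<lambda>x. u x + a * v x) \<in> unif_closure S (net_layer f k)"
  using assms by (cases k) (auto intro: unif_closure_lin)

text \<open>Approximate \<open>u\<close> by \<open>v\<close> in layer \<open>k\<close> and
  \<open>h\<close> by \<open>\<psi>\<close>. The inner affine maps of \<open>\<psi>\<close> are
  absorbed into layer \<open>k\<close>, so \<open>\<psi>\<close> after \<open>v\<close> is exactly a
  member of the next layer.\<close>

lemma net_closure_compose:
  assumes h: "h \<in> act_closure f" and cont: "continuous_on UNIV h"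
    and u: "u \<in> unif_closure S (net_layer f k)" and bnd: "\<And>x. x \<in> S \<Longrightarrow> \<bar>u x\<bar> \<le> B"
  shows "(\<lambda>x. h (u x)) \<in> unif_closure S (net_layer f (Suc k))"
  unfolding unif_closure_def
proof (intro CollectI allI impI)
  fix e :: real assume "e > 0"
  then have e: "e / 2 > 0" by simp
  \<comment> \<open>The margin 1 leaves room for \<open>v\<close>, which is taken within
    \<open>min \<eta> 1\<close> of \<open>u\<close>.\<close>
  let ?I = "{-(B + 1)..B + 1}" and ?A = "{\<lambda>t. f (a * t + b) |a b. True}"
  have "uniformly_continuous_on ?I h"
    by (intro compact_uniformly_continuous continuous_on_subset[OF cont]) auto
  then obtain \<eta> where \<eta>: "\<eta> > 0"
      "\<And>x y. x \<in> ?I \<Longrightarrow> y \<in> ?I \<Longrightarrow> \<bar>y - x\<bar> < \<eta> \<Longrightarrow> \<bar>h y - h x\<bar> < e / 2"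
    using e unfolding uniformly_continuous_on_def dist_real_def by metis
  have "min \<eta> 1 > 0" using \<eta>(1) by simp
  from unif_closureD[OF u this] obtain v where v: "v \<in> net_layer f k"
      "\<And>x. x \<in> S \<Longrightarrow> \<bar>v x - u x\<bar> < min \<eta> 1"
    by blast
  have "h \<in> unif_closure ?I (affine_span ?A)"
    using h unfolding act_closure_def by blast
  from unif_closureD[OF this e] obtain \<psi> where \<psi>: "\<psi> \<in> affine_span ?A"
      "\<And>t. t \<in> ?I \<Longrightarrow> \<bar>\<psi> t - h t\<bar> < e / 2"
    by blast
  have mem: "(\<lambda>x. \<psi> (v x)) \<in> net_layer f (Suc k)"
    unfolding net_layer.simps
  proof (rule affine_span_compose[OF \<psi>(1)])
    fix w assume "w \<in> ?A"
    then obtain a b where w: "w = (\<lambda>t. f (a * t + b))" by blast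
    show "(\<lambda>x. w (v x)) \<in> affine_span ((\<lambda>u x. f (u x)) ` net_layer f k)"
      unfolding w by (intro affine_span_incl image_eqI[OF _ net_layer_affine[OF v(1), of a b]]) simp
  qed
  have "\<bar>\<psi> (v x) - h (u x)\<bar> < e" if x: "x \<in> S" for x
  proof -
    have I: "u x \<in> ?I" "v x \<in> ?I"
      using bnd[OF x] v(2)[OF x] unfolding atLeastAtMost_iff by linarith+
    have "\<bar>h (v x) - h (u x)\<bar> < e / 2"
      using \<eta>(2)[OF I] v(2)[OF x] by simp
    with \<psi>(2)[OF I(2)] show ?thesis by linarith
  qed
  with mem show "\<exists>w\<in>net_layer f (Suc k). \<forall>x\<in>S. \<bar>w x - h (u x)\<bar> < e"
    by (intro bexI[of _ "\<lambda>x. \<psi> (v x)"] ballI)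
qed

section \<open>Stone-Weierstrass on a compact set\<close>

context
  fixes f :: "real \<Rightarrow> real" and C :: "(real ^ 'm::finite) set"
  assumes cont: "continuous_on UNIV f" and nonaff: "\<not> (\<exists>a b. \<forall>t. f t = a * t + b)"
    and C: "compact C"
begin

lemma net_closure_compose_continuous:
  assumes "h \<in> act_closure f" "continuous_on UNIV h"
    and "u \<in> unif_closure C (net_layer f k)" "continuous_on C u"
  shows "(\<lambda>x. h (u x)) \<in> unif_closure C (net_layer f (Suc k))"
proof -
  have "bounded (u ` C)"
    using assms(4) C by (intro compact_imp_bounded compact_continuous_image)
  then obtain B where "\<And>x. x \<in> C \<Longrightarrow> \<bar>u x\<bar> \<le> B"
    by (auto simp: bounded_iff)
  then show ?thesis
    using net_closure_compose[OF assms(1,2,3)] by blast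
qed

text \<open>The approximable identity copies a function through one more layer at a time. The
  nesting concerns the closures, not the layers themselves.\<close>

lemma net_closure_mono:
  assumes "u \<in> unif_closure C (net_layer f k)" "continuous_on C u" "k \<le> l"
  shows "u \<in> unif_closure C (net_layer f l)"
  using assms(3)
proof (induction l rule: dec_induct)
  case base
  show ?case by (rule assms(1))
next
  case (step l)
  show ?case
    using net_closure_compose_continuous[OF act_closure_id[OF cont nonaff] _ step(3) assms(2)]
    by (simp del: net_layer.simps)
qed

text \<open>Products come from squares by polarisation.\<close>

lemma net_closure_mult:
  assumes u: "u \<in> unif_closure C (net_layer f k)" "continuous_on C u"
    and v: "v \<in> unif_closure C (net_layer f k)" "continuous_on C v"
  shows "(\<lambda>x. u x * v x) \<in> unif_closure C (net_layer f (Suc k))"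
proof -
  have sq: "(\<lambda>x. (u x + a * v x)\<^sup>2) \<in> unif_closure C (net_layer f (Suc k))" for a
    by (rule net_closure_compose_continuous[OF act_closure_square[OF cont nonaff] _ net_closure_lin])
      (auto intro!: continuous_intros u v)
  have "(\<lambda>x. (0 + (1/4) * (u x + 1 * v x)\<^sup>2) + (-1/4) * (u x + (-1) * v x)\<^sup>2)
      \<in> unif_closure C (net_layer f (Suc k))"
    by (rule net_closure_lin[OF net_closure_lin[OF net_closure_const sq] sq])
  moreover have "(0 + (1/4) * (u x + 1 * v x)\<^sup>2) + (-1/4) * (u x + (-1) * v x)\<^sup>2 = u x * v x" for x
    by (simp add: power2_eq_square algebra_simps)
  ultimately show ?thesis by simp
qed

text \<open>All sufficiently large depths are asserted, so that the components of a vector-valued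
  function can share one depth.\<close>

lemma net_layer_dense:
  assumes g: "continuous_on C g" and e: "e > 0"
  shows "\<exists>k0. \<forall>k\<ge>k0. \<exists>u\<in>net_layer f k. \<forall>x\<in>C. \<bar>u x - g x\<bar> < e"
proof -
  \<comment> \<open>The depth is left free because each product costs a layer; \<open>common\<close>
    then brings two members to the larger of their depths. Continuity supplies the bounds on
    \<open>C\<close> needed for composition.\<close>
  let ?P = "\<lambda>u. continuous_on C u \<and> (\<exists>k. u \<in> unif_closure C (net_layer f k))"
  have common: "\<exists>k. u \<in> unif_closure C (net_layer f k) \<and> v \<in> unif_closure C (net_layer f k)"
    if "?P u" "?P v" for u v
    using that net_closure_mono by (metis max.cobounded1 max.cobounded2)
  have "\<exists>v. ?P v \<and> (\<forall>x\<in>C. \<bar>g x - v x\<bar> < e / 2)"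
  proof (rule Stone_Weierstrass_HOL[OF C])
    show "?P (\<lambda>x. c)" for c
      using net_closure_const[of c C f 0] by (blast intro: continuous_on_const)
    show "?P (\<lambda>x. u x + v x)" if uv: "?P u \<and> ?P v" for u v
    proof -
      obtain k where "u \<in> unif_closure C (net_layer f k)" "v \<in> unif_closure C (net_layer f k)"
        using common uv by blast
      from net_closure_lin[OF this, of 1] show ?thesis
        using uv by (auto intro!: continuous_on_add)
    qed
    show "?P (\<lambda>x. u x * v x)" if uv: "?P u \<and> ?P v" for u v
    proof -
      obtain k where "u \<in> unif_closure C (net_layer f k)" "v \<in> unif_closure C (net_layer f k)"
        using common uv by blast
      then show ?thesis
        using net_closure_mult uv by (blast intro: continuous_on_mult)
    qed
    show "\<exists>u. ?P u \<and> u x \<noteq> u y" if "x \<in> C \<and> y \<in> C \<and> x \<noteq> y" for x y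
    proof -
      from that obtain i where "x $ i \<noteq> y $ i" by (auto simp: vec_eq_iff)
      moreover have "(\<lambda>x. x $ i) \<in> unif_closure C (net_layer f 0)"
        by (auto intro!: unif_closure_incl affine_span_incl)
      ultimately show ?thesis
        by (intro exI[of _ "\<lambda>x. x $ i"] conjI exI[of _ 0] continuous_intros)
    qed
  qed (use g e in auto)
  then obtain v where Pv: "?P v \<and> (\<forall>x\<in>C. \<bar>g x - v x\<bar> < e / 2)" ..
  then have gv: "\<forall>x\<in>C. \<bar>g x - v x\<bar> < e / 2" ..
  from Pv obtain k0 where v: "continuous_on C v" "v \<in> unif_closure C (net_layer f k0)"
    by (elim exE conjE)
  have "\<exists>u\<in>net_layer f k. \<forall>x\<in>C. \<bar>u x - g x\<bar> < e" if k: "k \<ge> k0" for k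
  proof -
    obtain u where u: "u \<in> net_layer f k" "\<And>x. x \<in> C \<Longrightarrow> \<bar>u x - v x\<bar> < e / 2"
      using unif_closureD[OF net_closure_mono[OF v(2,1) k], of "e / 2"] e by auto
    have "\<bar>u x - g x\<bar> < e" if "x \<in> C" for x
      using u(2)[OF that] bspec[OF gv that] by linarith
    with u(1) show ?thesis by blast
  qed
  then show ?thesis by blast
qed

lemma net_layer_dense_vector:
  fixes g :: "real ^ 'm \<Rightarrow> real ^ 'c::finite"
  assumes g: "continuous_on C g" and e: "e > 0"
  shows "\<exists>k w. range w \<subseteq> net_layer f k \<and> (\<forall>x\<in>C. norm ((\<chi> j. w j x) - g x) < e)"
proof -
  \<comment> \<open>The Euclidean norm is at most the sum of the absolute components, of which there
    are \<open>CARD('c)\<close>.\<close>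
  define \<delta> where "\<delta> = e / real CARD('c)"
  have \<delta>: "\<delta> > 0" using e by (simp add: \<delta>_def)
  have "\<exists>k0. \<forall>k\<ge>k0. \<exists>u\<in>net_layer f k. \<forall>x\<in>C. \<bar>u x - g x $ j\<bar> < \<delta>" for j
    by (intro net_layer_dense \<delta> continuous_intros g)
  then obtain k0 where k0:
      "\<And>j k. k \<ge> k0 j \<Longrightarrow> \<exists>u\<in>net_layer f k. \<forall>x\<in>C. \<bar>u x - g x $ j\<bar> < \<delta>"
    by metis
  define k where "k = Max (range k0)"
  have "\<exists>u\<in>net_layer f k. \<forall>x\<in>C. \<bar>u x - g x $ j\<bar> < \<delta>" for j
    by (intro k0) (simp add: k_def)
  then obtain w where w: "\<And>j. w j \<in> net_layer f k"
      "\<And>j x. x \<in> C \<Longrightarrow> \<bar>w j x - g x $ j\<bar> < \<delta>"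
    by metis
  have "norm ((\<chi> j. w j x) - g x) < e" if x: "x \<in> C" for x
  proof -
    have "norm ((\<chi> j. w j x) - g x) \<le> (\<Sum>j\<in>UNIV. \<bar>w j x - g x $ j\<bar>)"
      using norm_le_l1_cart[of "(\<chi> j. w j x) - g x"] by simp
    also have "\<dots> < (\<Sum>j\<in>(UNIV :: 'c set). \<delta>)"
      by (intro sum_strict_mono w x) auto
    also have "\<dots> = e" by (simp add: \<delta>_def)
    finally show ?thesis .
  qed
  with w(1) show ?thesis by blast
qed

end

section \<open>Realization by graph neural machines\<close>

text \<open>The union of the finite supports of the members of \<open>U\<close> works, since each
  representation extends to any finite superset.\<close>

lemma affine_span_image_common:
  assumes "finite U" "U \<subseteq> affine_span (\<phi> ` L)"
  obtains V where "finite V" "V \<subseteq> L"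
    "\<And>u. u \<in> U \<Longrightarrow> \<exists>c w. \<forall>x. u x = c + (\<Sum>p\<in>V. w p * \<phi> p x)"
proof -
  have "\<forall>u\<in>U. \<exists>W. finite W \<and> W \<subseteq> L \<and>
      (\<forall>V. finite V \<longrightarrow> W \<subseteq> V \<longrightarrow> (\<exists>c w. \<forall>x. u x = c + (\<Sum>p\<in>V. w p * \<phi> p x)))"
    using assms(2) by (intro ballI affine_span_imageD) (rule subsetD)
  from bchoice[OF this] obtain W where W: "\<forall>u\<in>U. finite (W u) \<and> W u \<subseteq> L \<and>
      (\<forall>V. finite V \<longrightarrow> W u \<subseteq> V \<longrightarrow> (\<exists>c w. \<forall>x. u x = c + (\<Sum>p\<in>V. w p * \<phi> p x)))" ..
  show thesis
  proof (rule that)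
    show fin: "finite (\<Union>u\<in>U. W u)" "(\<Union>u\<in>U. W u) \<subseteq> L"
      using W assms(1) by auto
    show "\<exists>c w. \<forall>x. u x = c + (\<Sum>p\<in>(\<Union>u\<in>U. W u). w p * \<phi> p x)" if "u \<in> U" for u
      using bspec[OF W that] fin(1) that by (elim conjE allE[of _ "\<Union>u\<in>U. W u"]) (blast intro: UN_upper)
  qed
qed

lemma finite_gnm_nodes [simp]: "finite (gnm_nodes N)"
  unfolding gnm_nodes_def by simp

text \<open>Lets the weights of a later layer be overwritten without disturbing the features already
  computed.\<close>

lemma gnm_feature_cong:
  assumes "\<And>j. j \<le> k \<Longrightarrow> \<alpha> j = \<beta> j"
  shows "gnm_feature f N K \<alpha> x k = gnm_feature f N K \<beta> x k"
  using assms by (induction k) (auto simp: fun_eq_iff)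

text \<open>The induction needs arbitrary assignments \<open>\<sigma>\<close>: the hidden nodes one layer earlier are made to
  carry all the functions in terms of which the finitely many members of \<open>U\<close> are expressed.\<close>

lemma net_layer_realizable:
  fixes U :: "(real ^ 'm::finite \<Rightarrow> real) set"
  assumes "finite U" "U \<subseteq> net_layer f k"
  shows "\<exists>N0. \<forall>N\<ge>N0. \<forall>\<sigma>. range \<sigma> \<subseteq> U \<longrightarrow>
    (\<exists>\<alpha> :: ('m, 'c::finite) gnm_weights. \<forall>K>k. \<forall>x v.
       (\<Sum>u\<in>gnm_nodes N. \<alpha> (Suc k) u v * gnm_feature f N K \<alpha> x k u) = \<sigma> v x)"
  using assms
proof (induction k arbitrary: U)
  case 0
  have rep: "\<exists>c w. \<forall>x. u x = c + (\<Sum>i\<in>UNIV. w i * x $ i)" if "u \<in> U" for u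
    using affine_span_imageD[of u "\<lambda>i x. x $ i" UNIV] that 0(2) by fastforce
  have "\<exists>\<alpha> :: ('m, 'c) gnm_weights. \<forall>K>0. \<forall>x v.
       (\<Sum>u\<in>gnm_nodes N. \<alpha> (Suc 0) u v * gnm_feature f N K \<alpha> x 0 u) = \<sigma> v x"
    if \<sigma>: "range \<sigma> \<subseteq> U" for \<sigma> and N
  proof -
    have "\<forall>v. \<exists>c w. \<forall>x. \<sigma> v x = c + (\<Sum>i\<in>UNIV. w i * x $ i)"
      using rep \<sigma> by blast
    then obtain c w where cw: "\<And>v x. \<sigma> v x = c v + (\<Sum>i\<in>UNIV. w v i * x $ i)"
      by metis
    define \<alpha> :: "('m, 'c) gnm_weights" where
      "\<alpha> = (\<lambda>_ u v. case u of Input i \<Rightarrow> w v i | Bias \<Rightarrow> c v | _ \<Rightarrow> 0)"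
    have "(\<Sum>u\<in>gnm_nodes N. \<alpha> (Suc 0) u v * gnm_feature f N K \<alpha> x 0 u) = \<sigma> v x" for K x v
    proof -
      have "(\<Sum>u\<in>gnm_nodes N. \<alpha> (Suc 0) u v * gnm_feature f N K \<alpha> x 0 u)
          = (\<Sum>u\<in>insert Bias (range Input). \<alpha> (Suc 0) u v * gnm_feature f N K \<alpha> x 0 u)"
        by (rule sum.mono_neutral_right) (auto simp: gnm_nodes_def \<alpha>_def)
      also have "\<dots> = c v + (\<Sum>u\<in>range Input. \<alpha> (Suc 0) u v * gnm_feature f N K \<alpha> x 0 u)"
        by (subst sum.insert) (auto simp: \<alpha>_def)
      also have "\<dots> = \<sigma> v x"
        unfolding cw by (subst sum.reindex) (auto simp: \<alpha>_def inj_on_def)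
      finally show ?thesis .
    qed
    then show ?thesis by blast
  qed
  then show ?case by blast
next
  case (Suc k)
  obtain V where V: "finite V" "V \<subseteq> net_layer f k"
      "\<And>u. u \<in> U \<Longrightarrow> \<exists>c w. \<forall>x. u x = c + (\<Sum>p\<in>V. w p * f (p x))"
    using affine_span_image_common[of U "\<lambda>u x. f (u x)" "net_layer f k"] Suc.prems by auto
  \<comment> \<open>The zero function is a filler assigned to the nodes that carry no member of
    \<open>V\<close>.\<close>
  define z :: "real ^ 'm \<Rightarrow> real" where "z = (\<lambda>_. 0)"
  have "z \<in> net_layer f k"
    unfolding z_def by (cases k) (auto intro: affine_span.const)
  then have "insert z V \<subseteq> net_layer f k" "finite (insert z V)"
    using V by auto
  from Suc.IH[OF this(2,1)] obtain N0 where N0: "\<And>N \<sigma>. N \<ge> N0 \<Longrightarrow> range \<sigma> \<subseteq> insert z V \<Longrightarrow>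
    \<exists>\<alpha> :: ('m, 'c) gnm_weights. \<forall>K>k. \<forall>x v.
       (\<Sum>u\<in>gnm_nodes N. \<alpha> (Suc k) u v * gnm_feature f N K \<alpha> x k u) = \<sigma> v x"
    by blast
  obtain e where e: "bij_betw e {..<card V} V"
    using ex_bij_betw_nat_finite[OF V(1)] by (auto simp: atLeast0LessThan)
  \<comment> \<open>Leaves room for \<open>card V\<close> hidden nodes, one for each member of
    \<open>V\<close>.\<close>
  define N1 where "N1 = max N0 (card V + CARD('m) + CARD('c))"
  have "\<exists>\<alpha> :: ('m, 'c) gnm_weights. \<forall>K>Suc k. \<forall>x v.
       (\<Sum>u\<in>gnm_nodes N. \<alpha> (Suc (Suc k)) u v * gnm_feature f N K \<alpha> x (Suc k) u) = \<sigma> v x"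
    if N: "N \<ge> N1" and \<sigma>: "range \<sigma> \<subseteq> U" for N \<sigma>
  proof -
    have "\<forall>v. \<exists>c w. \<forall>x. \<sigma> v x = c + (\<Sum>p\<in>V. w p * f (p x))"
      using V(3) \<sigma> by blast
    then obtain c w where cw: "\<And>v x. \<sigma> v x = c v + (\<Sum>p\<in>V. w v p * f (p x))"
      by metis
    define \<tau> where "\<tau> = (\<lambda>v :: ('m, 'c) gnm_node.
      case v of Hidden j \<Rightarrow> if j < card V then e j else z | _ \<Rightarrow> z)"
    have "range \<tau> \<subseteq> insert z V"
      using bij_betwE[OF e] by (auto simp: \<tau>_def split: gnm_node.splits)
    then obtain \<alpha> :: "('m, 'c) gnm_weights" where \<alpha>: "\<And>K x v. K > k \<Longrightarrow>
        (\<Sum>u\<in>gnm_nodes N. \<alpha> (Suc k) u v * gnm_feature f N K \<alpha> x k u) = \<tau> v x"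
      using N0[of N \<tau>] N unfolding N1_def by fastforce
    \<comment> \<open>Only layer \<open>Suc (Suc k)\<close> is new. Filler nodes get weight 0, which
      discards their value \<open>f 0\<close>, and the bias edge supplies the constant.\<close>
    define \<beta> where "\<beta> = \<alpha>(Suc (Suc k) := \<lambda>u v. case u of
      Hidden j \<Rightarrow> if j < card V then w v (e j) else 0 | Bias \<Rightarrow> c v | _ \<Rightarrow> 0)"
    \<comment> \<open>Layer \<open>Suc k\<close> is not the last one when \<open>K > Suc k\<close>,
      so \<open>f\<close> and not the identity is applied there.\<close>
    have feature: "gnm_feature f N K \<beta> x (Suc k) (Hidden j) = f (e j x)"
      if "K > Suc k" "j < card V" for K x j
    proof -
      have "gnm_feature f N K \<beta> x (Suc k) = gnm_feature f N K \<alpha> x (Suc k)"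
        by (rule gnm_feature_cong) (simp add: \<beta>_def)
      then show ?thesis
        using \<alpha>[of K "Hidden j" x] that by (simp add: \<tau>_def)
    qed
    have "(\<Sum>u\<in>gnm_nodes N. \<beta> (Suc (Suc k)) u v * gnm_feature f N K \<beta> x (Suc k) u) = \<sigma> v x"
      if K: "K > Suc k" for K x v
    proof -
      let ?s = "\<lambda>u. \<beta> (Suc (Suc k)) u v * gnm_feature f N K \<beta> x (Suc k) u"
      have "sum ?s (gnm_nodes N) = sum ?s (insert Bias (Hidden ` {..<card V}))"
        using N by (intro sum.mono_neutral_right)
          (auto simp: gnm_nodes_def \<beta>_def N1_def simp del: gnm_feature.simps)
      also have "\<dots> = c v + sum ?s (Hidden ` {..<card V})"
        by (subst sum.insert) (auto simp: \<beta>_def)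
      also have "sum ?s (Hidden ` {..<card V}) = (\<Sum>j<card V. w v (e j) * f (e j x))"
        by (subst sum.reindex)
          (auto simp: inj_on_def \<beta>_def feature[unfolded \<beta>_def] K simp del: gnm_feature.simps)
      also have "\<dots> = (\<Sum>p\<in>V. w v p * f (p x))"
        by (rule sum.reindex_bij_betw[OF e])
      finally show ?thesis unfolding cw .
    qed
    then show ?thesis by blast
  qed
  then show ?case by blast
qed

theorem corollary5p2:
  fixes f :: "real \<Rightarrow> real"
    and C :: "(real ^ 'm::finite) set"
    and g :: "real ^ 'm \<Rightarrow> real ^ 'c::finite"
    and \<epsilon> :: real
  assumes "continuous_on UNIV f"
    and "\<not> (\<exists>a b. \<forall>t. f t = a * t + b)"
    and "compact C"
    and "continuous_on C g"
    and "\<epsilon> > 0"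
  shows "\<exists>N K. \<exists>M :: real ^ 'm \<Rightarrow> real ^ 'c.
           is_gnm f N K M \<and> (SUP x\<in>C. ereal (norm (M x - g x))) < ereal \<epsilon>"
proof -
  \<comment> \<open>Half of \<open>\<epsilon>\<close> is used because pointwise strict bounds give
    only a weak bound on the supremum.\<close>
  obtain k w where w: "range w \<subseteq> net_layer f k"
      "\<And>x. x \<in> C \<Longrightarrow> norm ((\<chi> j. w j x) - g x) < \<epsilon> / 2"
    using net_layer_dense_vector[OF assms(1-4), of "\<epsilon> / 2"] assms(5) by auto
  have "\<exists>N0. \<forall>N\<ge>N0. \<forall>\<sigma>. range \<sigma> \<subseteq> range w \<longrightarrow>
    (\<exists>\<alpha> :: ('m, 'c) gnm_weights. \<forall>K>k. \<forall>x v.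
       (\<Sum>u\<in>gnm_nodes N. \<alpha> (Suc k) u v * gnm_feature f N K \<alpha> x k u) = \<sigma> v x)"
    by (rule net_layer_realizable[OF _ w(1)]) simp
  then obtain N0 where N0: "\<And>N \<sigma>. N \<ge> N0 \<Longrightarrow> range \<sigma> \<subseteq> range w \<Longrightarrow>
    \<exists>\<alpha> :: ('m, 'c) gnm_weights. \<forall>K>k. \<forall>x v.
       (\<Sum>u\<in>gnm_nodes N. \<alpha> (Suc k) u v * gnm_feature f N K \<alpha> x k u) = \<sigma> v x"
    by blast
  define N where "N = max N0 (CARD('m) + CARD('c))"
  \<comment> \<open>Only the output nodes matter; \<open>w undefined\<close> is an arbitrary member
    of \<open>range w\<close> for the others.\<close>
  define \<sigma> where "\<sigma> = (\<lambda>v :: ('m, 'c) gnm_node. case v of Output j \<Rightarrow> w j | _ \<Rightarrow> w undefined)"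
  have "range \<sigma> \<subseteq> range w"
    by (auto simp: \<sigma>_def split: gnm_node.splits)
  then obtain \<alpha> :: "('m, 'c) gnm_weights" where \<alpha>: "\<And>x v.
      (\<Sum>u\<in>gnm_nodes N. \<alpha> (Suc k) u v * gnm_feature f N (Suc k) \<alpha> x k u) = \<sigma> v x"
    using N0[of N \<sigma>] unfolding N_def by fastforce
  \<comment> \<open>With \<open>K = Suc k\<close> the last layer applies the identity, so the
    outputs are exactly the prescribed sums.\<close>
  have out: "gnm_output f N (Suc k) \<alpha> x = (\<chi> j. w j x)" for x
    unfolding gnm_output_def by (simp add: \<alpha>) (simp add: \<sigma>_def)
  have "(SUP x\<in>C. ereal (norm (gnm_output f N (Suc k) \<alpha> x - g x))) \<le> ereal (\<epsilon> / 2)"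
    using w(2) by (intro SUP_least) (auto simp: out intro: less_imp_le)
  also have "\<dots> < ereal \<epsilon>"
    using assms(5) by simp
  finally show ?thesis
    unfolding is_gnm_def N_def by (intro exI[of _ N] exI[of _ "Suc k"]
        exI[of _ "gnm_output f N (Suc k) \<alpha>"]) (auto simp: N_def)
qed

end
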